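(* Consider the adjacency-list model augmented with $\texttt{JUMP}$, $\texttt{IN-SORTED}$ and $\texttt{ADJ}$. For any $n$ and $m$ with $n\le m\le n^2$ and any $\delta\in(0,1]$, there exists a directed graph $G=(V,E)$ with $\Theta(n)$ nodes, $\Theta(m)$ edges, and nodes $s,t\in V$, such that for any algorithm solving the single-pair problem, the expected running time on $G$ with source $s$, target $t$ and approximation threshold $\delta$ is $\Omega(\min\{m,1/\delta\})$.
   Context: Fix a constant $\alpha\in(0,1)$. For a directed graph $G=(V,E)$, an $\alpha$-discounted random walk from a node $s$: at each step, with probability $\alpha$ it terminates at the current node, and otherwise it moves to a uniformly random out-neighbor of the current node. $\pi(s,t)$ is the probability that such a walk from $s$ terminates at $t$. Adjacency-list model: an algorithm accesses $G$ only through constant-time queries $\texttt{DEG-IN}(u)$, $\texttt{DEG-OUT}(u)$ (in-/out-degree of $u$), $\texttt{IN}(u,i)$, $\texttt{OUT}(u,i)$ ($i$-th in-/out-neighbor of $u$). Additional queries: $\texttt{ADJ}(u,v)$ returns whether $(u,v)\in E$; $\texttt{IN-SORTED}(u,i)$ returns the $i$-th in-neighbor of $u$ when in-neighbors are sorted by out-degree; $\texttt{JUMP}()$ returns a uniformly random node of $V$. Single-pair problem: given $G$ (via queries), $s,t\in V$ and $\delta\in(0,1]$, output $\hat\pi(s,t)$ with $\Pr\{|\hat\pi(s,t)-\pi(s,t)|\ge\varepsilon\max\{\pi(s,t),\delta\}\}\le p_f$, where $\varepsilon,p_f$ are fixed small constants; an algorithm solves the problem if this holds for every input. *)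

theory Defs
  imports "HOL-Probability.Probability" "HOL-Probability.SPMF" "Graph_Theory.Pair_Digraph"
begin

text \<open>
  Nodes are named by \<open>0, \<dots>, N - 1\<close>; there are no parallel edges, self-loops are allowed. Every node
  has an out-neighbor, so that each step of the random walk is well defined.
\<close>

definition input_graph :: "nat pair_pre_digraph \<Rightarrow> bool" where
  "input_graph G \<longleftrightarrow> pair_fin_digraph G \<and> (\<exists>N. pverts G = {..<N}) \<and>
     (\<forall>u\<in>pverts G. out_degree (with_proj G) u > 0)"

definition out_nbrs :: "'a pair_pre_digraph \<Rightarrow> 'a \<Rightarrow> 'a set" where
  "out_nbrs G u = {v. (u, v) \<in> parcs G}"

definition in_nbrs :: "'a pair_pre_digraph \<Rightarrow> 'a \<Rightarrow> 'a set" where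
  "in_nbrs G u = {v. (v, u) \<in> parcs G}"

text \<open>Distribution of the node at which the walk started in \<open>u\<close> terminates.\<close>

partial_function (spmf) discounted_walk ::
    "real \<Rightarrow> 'a pair_pre_digraph \<Rightarrow> 'a \<Rightarrow> 'a spmf" where
  "discounted_walk \<alpha> G u =
     bind_pmf (bernoulli_pmf \<alpha>) (\<lambda>stop.
       if stop then return_spmf u
       else bind_pmf (pmf_of_set (out_nbrs G u)) (\<lambda>v. discounted_walk \<alpha> G v))"

definition ppr :: "real \<Rightarrow> 'a pair_pre_digraph \<Rightarrow> 'a \<Rightarrow> 'a \<Rightarrow> real" where
  "ppr \<alpha> G s t = spmf (discounted_walk \<alpha> G s) t"

text \<open>
  The orders in which the neighbors are listed belong to the representation of the graph, not to
  the graph. \<open>in_sorted_list\<close> may break ties between equal out-degrees in any way.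
\<close>

record adj_lists =
  out_list :: "nat \<Rightarrow> nat list"
  in_list :: "nat \<Rightarrow> nat list"
  in_sorted_list :: "nat \<Rightarrow> nat list"

definition represents :: "adj_lists \<Rightarrow> nat pair_pre_digraph \<Rightarrow> bool" where
  "represents L G \<longleftrightarrow> (\<forall>u\<in>pverts G.
     distinct (out_list L u) \<and> set (out_list L u) = out_nbrs G u \<and>
     distinct (in_list L u) \<and> set (in_list L u) = in_nbrs G u \<and>
     distinct (in_sorted_list L u) \<and> set (in_sorted_list L u) = in_nbrs G u \<and>
     sorted (map (out_degree (with_proj G)) (in_sorted_list L u)))"

datatype query =
  Deg_In nat | Deg_Out nat | In nat nat | Out nat nat | Adj nat nat | In_Sorted nat nat | Jump

datatype answer = Number nat | Node nat | Truth bool | Invalid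

definition list_answer :: "nat list \<Rightarrow> nat \<Rightarrow> answer" where
  "list_answer xs i = (if i < length xs then Node (xs ! i) else Invalid)"

text \<open>
  List positions count from 0. A query about a node or a position that does not exist
  is answered by \<open>Invalid\<close>.
\<close>

fun reply :: "nat pair_pre_digraph \<Rightarrow> adj_lists \<Rightarrow> query \<Rightarrow> answer pmf" where
  "reply G L (Deg_In u) =
     return_pmf (if u \<in> pverts G then Number (in_degree (with_proj G) u) else Invalid)"
| "reply G L (Deg_Out u) =
     return_pmf (if u \<in> pverts G then Number (out_degree (with_proj G) u) else Invalid)"
| "reply G L (In u i) =
     return_pmf (if u \<in> pverts G then list_answer (in_list L u) i else Invalid)"
| "reply G L (Out u i) =
     return_pmf (if u \<in> pverts G then list_answer (out_list L u) i else Invalid)"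
| "reply G L (In_Sorted u i) =
     return_pmf (if u \<in> pverts G then list_answer (in_sorted_list L u) i else Invalid)"
| "reply G L (Adj u v) =
     return_pmf (if u \<in> pverts G \<and> v \<in> pverts G then Truth ((u, v) \<in> parcs G) else Invalid)"
| "reply G L Jump = map_pmf Node (pmf_of_set (pverts G))"

text \<open>
  A randomized algorithm receives \<open>s\<close>, \<open>t\<close>, \<open>\<delta>\<close> and chooses its next elementary step from all it has
  seen so far, namely the answers to its queries and its own random draws. \<open>Local p\<close> is
  a step without access to the graph that draws from \<open>p\<close>; deterministic internal computation is the
  case of a one-point distribution. Every step, including the final output, costs one time unit.
\<close>

datatype action = Output real | Query query | Local "nat pmf"

datatype observation = Answered answer | Drawn nat

type_synonym algorithm = "nat \<Rightarrow> nat \<Rightarrow> real \<Rightarrow> observation list \<Rightarrow> action"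

text \<open>
  Joint distribution of the output and the remaining running time after the observations \<open>h\<close>, for
  an algorithm whose inputs \<open>s\<close>, \<open>t\<close>, \<open>\<delta>\<close> are fixed. The outcome \<open>None\<close> of the underlying
  distribution stands for non-termination.
\<close>

partial_function (spmf) run_from ::
    "(observation list \<Rightarrow> action) \<Rightarrow> nat pair_pre_digraph \<Rightarrow> adj_lists \<Rightarrow> observation list
      \<Rightarrow> (real \<times> nat) spmf" where
  "run_from B G L h =
     (case B h of
        Output x \<Rightarrow> return_spmf (x, 1)
      | Query q \<Rightarrow> bind_pmf (reply G L q) (\<lambda>a.
          map_spmf (\<lambda>(x, k). (x, k + 1)) (run_from B G L (h @ [Answered a])))
      | Local p \<Rightarrow> bind_pmf p (\<lambda>r.
          map_spmf (\<lambda>(x, k). (x, k + 1)) (run_from B G L (h @ [Drawn r]))))"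

definition run :: "algorithm \<Rightarrow> nat pair_pre_digraph \<Rightarrow> adj_lists \<Rightarrow> nat \<Rightarrow> nat \<Rightarrow> real
    \<Rightarrow> (real \<times> nat) spmf" where
  "run A G L s t \<delta> = run_from (A s t \<delta>) G L []"

definition expected_time ::
    "algorithm \<Rightarrow> nat pair_pre_digraph \<Rightarrow> adj_lists \<Rightarrow> nat \<Rightarrow> nat \<Rightarrow> real \<Rightarrow> ennreal" where
  "expected_time A G L s t \<delta> =
     (\<integral>\<^sup>+ r. (case r of None \<Rightarrow> \<infinity> | Some (x, k) \<Rightarrow> of_nat k) \<partial>measure_pmf (run A G L s t \<delta>))"

text \<open>Non-termination counts as failure.\<close>

definition failed :: "real \<Rightarrow> real \<Rightarrow> real \<Rightarrow> (real \<times> nat) option \<Rightarrow> bool" where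
  "failed \<epsilon> \<delta> p r \<longleftrightarrow> (case r of None \<Rightarrow> True | Some (x, k) \<Rightarrow> \<bar>x - p\<bar> \<ge> \<epsilon> * max p \<delta>)"

definition solves_single_pair :: "real \<Rightarrow> real \<Rightarrow> real \<Rightarrow> algorithm \<Rightarrow> bool" where
  "solves_single_pair \<alpha> \<epsilon> p\<^sub>f A \<longleftrightarrow>
     (\<forall>G L s t \<delta>. input_graph G \<and> represents L G \<and> s \<in> pverts G \<and> t \<in> pverts G \<and>
        0 < \<delta> \<and> \<delta> \<le> 1 \<longrightarrow>
        measure_pmf.prob (run A G L s t \<delta>) {r. failed \<epsilon> \<delta> (ppr \<alpha> G s t) r} \<le> p\<^sub>f)"

end

theory Submission
  imports Defs "HOL-Combinatorics.Transposition"
begin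

text \<open>
  The source reaches \<open>U\<close>, all arcs of \<open>U \<times> V\<close> are present, and so are all arcs of a disjoint
  \<open>X \<times> Y\<close> with \<open>|U| = |V| = |X| = |Y| = r\<close>, where \<open>Y\<close> leads to the target. In this graph
  \<open>\<pi>(s, t) = 0\<close>, but replacing \<open>(u, v)\<close>, \<open>(x, y)\<close> by \<open>(u, y)\<close>, \<open>(x, v)\<close> opens a path from
  \<open>s\<close> to \<open>t\<close> and raises \<open>\<pi>(s, t)\<close> to order \<open>1 / r\<^sup>2\<close>, which exceeds the error threshold when
  \<open>r\<^sup>2\<close> is a small multiple of \<open>1 / \<delta>\<close>. All degrees are preserved by the swap, and a query is
  answered differently for at most \<open>4 r\<^sup>2\<close> of the \<open>r\<^sup>4\<close> swaps. Summing over all swaps, the total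
  change of the output probabilities is at most \<open>4 r\<^sup>2\<close> times the expected number of steps on the
  unmodified graph, whereas correctness forces it to be at least \<open>(1 - 2 p\<^sub>f) r\<^sup>4\<close>.
\<close>

section \<open>Runs cut off after finitely many steps, and the effect of changed inputs on their
  output\<close>

definition running_time :: "(real \<times> nat) option \<Rightarrow> ennreal" where
  "running_time r = (case r of None \<Rightarrow> \<infinity> | Some (x, k) \<Rightarrow> of_nat k)"

text \<open>Cutting off at \<open>k\<close> steps gives inductions over a run a decreasing
  parameter, even though an algorithm need not terminate. \<open>P\<close> selects outputs.\<close>

definition done_within :: "(real \<Rightarrow> bool) \<Rightarrow> nat \<Rightarrow> (real \<times> nat) option set" where
  "done_within P k = {r. case r of None \<Rightarrow> False | Some (x, j) \<Rightarrow> P x \<and> j \<le> k}"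

lemma vimage_done_within:
  "map_option (\<lambda>(x, j). (x, Suc j)) -` done_within P (Suc k) = done_within P k"
  "map_option (\<lambda>(x, j). (x, Suc j)) -` done_within P 0 = {}"
  by (auto simp: done_within_def split: option.splits)

lemma Some_in_done_within: "Some (x, j) \<in> done_within P k \<longleftrightarrow> P x \<and> j \<le> k"
  by (simp add: done_within_def)

lemma running_time_Some: "running_time (Some (x, k)) = of_nat k"
  by (simp add: running_time_def)

lemma running_time_map:
  "running_time (map_option (\<lambda>(x, j). (x, Suc j)) r) = 1 + running_time r"
  by (auto simp: running_time_def split: option.splits)

lemma emeasure_run_from_0: "emeasure (run_from B G L h) (done_within P 0) = 0"
  by (subst run_from.simps) (cases "B h"; simp add: vimage_done_within Some_in_done_within)

lemma emeasure_run_from_Suc: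
  "emeasure (run_from B G L h) (done_within P (Suc k)) =
     (case B h of
        Output x \<Rightarrow> indicator {x. P x} x
      | Query q \<Rightarrow> \<integral>\<^sup>+a. emeasure (run_from B G L (h @ [Answered a])) (done_within P k) \<partial>reply G L q
      | Local p \<Rightarrow> \<integral>\<^sup>+a. emeasure (run_from B G L (h @ [Drawn a])) (done_within P k) \<partial>p)"
  by (subst run_from.simps)
    (cases "B h"; simp add: vimage_done_within Some_in_done_within indicator_def)

text \<open>No termination is assumed: divergence counts as infinity, which one more unit leaves
  unchanged, so the recursion always holds in \<open>ennreal\<close>.\<close>

lemma nn_integral_running_time:
  "(\<integral>\<^sup>+r. running_time r \<partial>run_from B G L h) =
     (case B h of
        Output x \<Rightarrow> 1
      | Query q \<Rightarrow> 1 + (\<integral>\<^sup>+a. \<integral>\<^sup>+r. running_time r \<partial>run_from B G L (h @ [Answered a]) \<partial>reply G L q)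
      | Local p \<Rightarrow> 1 + (\<integral>\<^sup>+a. \<integral>\<^sup>+r. running_time r \<partial>run_from B G L (h @ [Drawn a]) \<partial>p))"
  by (subst run_from.simps)
    (cases "B h"; simp add: running_time_map running_time_Some nn_integral_add measure_pmf.emeasure_space_1)

text \<open>
  \<open>J\<close> is the set of inputs not yet separated from \<open>(G, L)\<close>: a query removes at most \<open>C\<close> of them,
  each at the price of a probability at most 1, and the replies for the others are the same.
\<close>

lemma sum_emeasure_done_within_le:
  fixes G' :: "'i \<Rightarrow> nat pair_pre_digraph" and L' :: "'i \<Rightarrow> adj_lists"
  assumes "finite I"
    and hits: "\<And>q. card {i\<in>I. reply (G' i) (L' i) q \<noteq> reply G L q} \<le> C"
    and "J \<subseteq> I"
  shows "(\<Sum>i\<in>J. emeasure (run_from B G L h) (done_within P k)) \<le>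
    (\<Sum>i\<in>J. emeasure (run_from B (G' i) (L' i) h) (done_within P k)) +
      of_nat C * (\<integral>\<^sup>+r. running_time r \<partial>run_from B G L h)"
  using \<open>J \<subseteq> I\<close>
proof (induction k arbitrary: h J)
  case 0
  then show ?case by (simp add: emeasure_run_from_0)
next
  case (Suc k)
  define D where "D h' = emeasure (run_from B G L h') (done_within P k)" for h'
  define D' where "D' i h' = emeasure (run_from B (G' i) (L' i) h') (done_within P k)" for i h'
  define T where "T h' = (\<integral>\<^sup>+r. running_time r \<partial>run_from B G L h')" for h'
  have IH: "(\<Sum>i\<in>K. D h') \<le> (\<Sum>i\<in>K. D' i h') + of_nat C * T h'" if "K \<subseteq> J" for K h'
    unfolding D_def D'_def T_def using that Suc by (intro Suc.IH) auto
  \<comment> \<open>Averaging over a common distribution \<open>p\<close> of the next observation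
    preserves the estimate. This serves local draws as well as queries that are answered
    alike.\<close>
  have step: "(\<Sum>i\<in>K. \<integral>\<^sup>+a. D (f a) \<partial>p) \<le>
      (\<Sum>i\<in>K. \<integral>\<^sup>+a. D' i (f a) \<partial>p) + of_nat C * (\<integral>\<^sup>+a. T (f a) \<partial>p)"
    if "K \<subseteq> J" for K and f :: "'z \<Rightarrow> _" and p :: "'z pmf"
  proof -
    have "(\<Sum>i\<in>K. \<integral>\<^sup>+a. D (f a) \<partial>p) = (\<integral>\<^sup>+a. (\<Sum>i\<in>K. D (f a)) \<partial>p)"
      by (subst nn_integral_sum) auto
    also have "\<dots> \<le> (\<integral>\<^sup>+a. (\<Sum>i\<in>K. D' i (f a)) + of_nat C * T (f a) \<partial>p)"
      using that by (intro nn_integral_mono IH)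
    also have "\<dots> = (\<Sum>i\<in>K. \<integral>\<^sup>+a. D' i (f a) \<partial>p) + of_nat C * (\<integral>\<^sup>+a. T (f a) \<partial>p)"
      by (simp add: nn_integral_add nn_integral_sum nn_integral_cmult)
    finally show ?thesis .
  qed
  show ?case
  proof (cases "B h")
    case (Output x)
    then show ?thesis by (simp add: emeasure_run_from_Suc)
  next
    case (Local p)
    have "(\<Sum>i\<in>J. \<integral>\<^sup>+a. D (h @ [Drawn a]) \<partial>p) \<le>
        (\<Sum>i\<in>J. \<integral>\<^sup>+a. D' i (h @ [Drawn a]) \<partial>p) + of_nat C * (\<integral>\<^sup>+a. T (h @ [Drawn a]) \<partial>p)"
      by (rule step) simp
    also have "\<dots> \<le> (\<Sum>i\<in>J. \<integral>\<^sup>+a. D' i (h @ [Drawn a]) \<partial>p) +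
        of_nat C * (1 + (\<integral>\<^sup>+a. T (h @ [Drawn a]) \<partial>p))"
      by (intro add_left_mono mult_left_mono) auto
    finally show ?thesis
      unfolding emeasure_run_from_Suc nn_integral_running_time[of B G L h] Local
      by (simp add: D_def D'_def T_def)
  next
    case (Query q)
    define H where "H = {i\<in>J. reply (G' i) (L' i) q \<noteq> reply G L q}"
    have "finite J" using Suc.prems \<open>finite I\<close> by (rule finite_subset)
    have "card H \<le> card {i\<in>I. reply (G' i) (L' i) q \<noteq> reply G L q}"
      unfolding H_def using Suc.prems \<open>finite I\<close> by (intro card_mono) auto
    with hits[of q] have "card H \<le> C" by linarith
    let ?p = "reply G L q" and ?f = "\<lambda>a. h @ [Answered a]"
    have "(\<integral>\<^sup>+a. D (?f a) \<partial>?p) \<le> (\<integral>\<^sup>+a. 1 \<partial>?p)"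
      unfolding D_def by (intro nn_integral_mono measure_pmf.emeasure_le_1)
    then have "(\<integral>\<^sup>+a. D (?f a) \<partial>?p) \<le> 1"
      by (simp add: measure_pmf.emeasure_space_1)
    then have "(\<Sum>i\<in>H. \<integral>\<^sup>+a. D (?f a) \<partial>?p) \<le> (\<Sum>i\<in>H. 1)"
      by (intro sum_mono)
    also have "\<dots> \<le> of_nat C"
      using \<open>card H \<le> C\<close> by simp
    finally have hit: "(\<Sum>i\<in>H. \<integral>\<^sup>+a. D (?f a) \<partial>?p) \<le> of_nat C" .
    have "(\<Sum>i\<in>J - H. \<integral>\<^sup>+a. D (?f a) \<partial>?p) \<le>
        (\<Sum>i\<in>J - H. \<integral>\<^sup>+a. D' i (?f a) \<partial>?p) + of_nat C * (\<integral>\<^sup>+a. T (?f a) \<partial>?p)"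
      by (rule step) simp
    also have "(\<Sum>i\<in>J - H. \<integral>\<^sup>+a. D' i (?f a) \<partial>?p) =
        (\<Sum>i\<in>J - H. \<integral>\<^sup>+a. D' i (?f a) \<partial>reply (G' i) (L' i) q)"
      by (intro sum.cong) (auto simp: H_def)
    also have "\<dots> \<le> (\<Sum>i\<in>J. \<integral>\<^sup>+a. D' i (?f a) \<partial>reply (G' i) (L' i) q)"
      using \<open>finite J\<close> by (intro sum_mono2) auto
    finally have miss: "(\<Sum>i\<in>J - H. \<integral>\<^sup>+a. D (?f a) \<partial>?p) \<le>
        (\<Sum>i\<in>J. \<integral>\<^sup>+a. D' i (?f a) \<partial>reply (G' i) (L' i) q) + of_nat C * (\<integral>\<^sup>+a. T (?f a) \<partial>?p)"
      by simp
    \<comment> \<open>The inputs in \<open>H\<close> cost at most \<open>C\<close> in total; the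
      unit that the present query adds to the running time pays for this.\<close>
    have "(\<Sum>i\<in>J. \<integral>\<^sup>+a. D (?f a) \<partial>?p) =
        (\<Sum>i\<in>J - H. \<integral>\<^sup>+a. D (?f a) \<partial>?p) + (\<Sum>i\<in>H. \<integral>\<^sup>+a. D (?f a) \<partial>?p)"
      using \<open>finite J\<close> by (intro sum.subset_diff) (auto simp: H_def)
    also have "\<dots> \<le> ((\<Sum>i\<in>J. \<integral>\<^sup>+a. D' i (?f a) \<partial>reply (G' i) (L' i) q) +
        of_nat C * (\<integral>\<^sup>+a. T (?f a) \<partial>?p)) + of_nat C"
      by (intro add_mono miss hit)
    also have "\<dots> = (\<Sum>i\<in>J. \<integral>\<^sup>+a. D' i (?f a) \<partial>reply (G' i) (L' i) q) +
        of_nat C * (1 + (\<integral>\<^sup>+a. T (?f a) \<partial>?p))"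
      by (simp add: distrib_left ac_simps)
    finally show ?thesis
      unfolding emeasure_run_from_Suc nn_integral_running_time[of B G L h] Query
      by (simp add: D_def D'_def T_def)
  qed
qed

lemma expected_time_ge_1: "expected_time A G L s t \<delta> \<ge> 1"
  unfolding expected_time_def run_def running_time_def[symmetric]
  by (subst nn_integral_running_time) (simp split: action.split)

text \<open>The events \<open>done_within P k\<close> increase to \<open>S\<close>. Enlarging them
  to \<open>S\<close> for the changed inputs makes the bound independent of \<open>k\<close>, so it
  passes to the supremum.\<close>

lemma sum_emeasure_output_le:
  fixes G' :: "'i \<Rightarrow> nat pair_pre_digraph" and L' :: "'i \<Rightarrow> adj_lists" and P :: "real \<Rightarrow> bool"
  assumes "finite I"
    and "\<And>q. card {i\<in>I. reply (G' i) (L' i) q \<noteq> reply G L q} \<le> C"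
  defines "S \<equiv> {r. case r of None \<Rightarrow> False | Some (x, j) \<Rightarrow> P x}"
  shows "(\<Sum>i\<in>I. emeasure (run A G L s t \<delta>) S) \<le>
    (\<Sum>i\<in>I. emeasure (run A (G' i) (L' i) s t \<delta>) S) + of_nat C * expected_time A G L s t \<delta>"
proof -
  have S: "S = (\<Union>k. done_within P k)"
    unfolding S_def by (auto simp: done_within_def split: option.splits)
  have "of_nat (card I) * emeasure (run A G L s t \<delta>) S =
      of_nat (card I) * (SUP k. emeasure (run A G L s t \<delta>) (done_within P k))"
    unfolding S by (subst SUP_emeasure_incseq)
      (auto simp: incseq_def done_within_def split: option.splits)
  also have "\<dots> = (SUP k. of_nat (card I) * emeasure (run A G L s t \<delta>) (done_within P k))"
    by (simp add: SUP_mult_left_ennreal)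
  also have "\<dots> \<le> (\<Sum>i\<in>I. emeasure (run A (G' i) (L' i) s t \<delta>) S) +
      of_nat C * expected_time A G L s t \<delta>"
  proof (rule SUP_least)
    fix k
    have "(\<Sum>i\<in>I. emeasure (run A G L s t \<delta>) (done_within P k)) \<le>
        (\<Sum>i\<in>I. emeasure (run A (G' i) (L' i) s t \<delta>) (done_within P k)) +
          of_nat C * expected_time A G L s t \<delta>"
      unfolding run_def expected_time_def running_time_def[symmetric]
      by (intro sum_emeasure_done_within_le[of I G' L' G L C]) (use assms in auto)
    also have "\<dots> \<le> (\<Sum>i\<in>I. emeasure (run A (G' i) (L' i) s t \<delta>) S) +
        of_nat C * expected_time A G L s t \<delta>"
      unfolding S by (intro add_right_mono sum_mono emeasure_mono) auto
    finally show "of_nat (card I) * emeasure (run A G L s t \<delta>) (done_within P k) \<le> \<dots>"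
      by simp
  qed
  finally show ?thesis by simp
qed

section \<open>First-step recursion for the walk, and bounds derived from it\<close>

lemma ppr_unfold:
  assumes "0 < \<alpha>" "\<alpha> < 1" "finite (out_nbrs G u)" "out_nbrs G u \<noteq> {}"
  shows "ppr \<alpha> G u t = (if u = t then \<alpha> else 0) +
    (1 - \<alpha>) * ((\<Sum>v\<in>out_nbrs G u. ppr \<alpha> G v t) / real (card (out_nbrs G u)))"
proof -
  have "ppr \<alpha> G u t = \<alpha> * spmf (return_spmf u) t +
      (1 - \<alpha>) * spmf (bind_pmf (pmf_of_set (out_nbrs G u)) (discounted_walk \<alpha> G)) t"
    unfolding ppr_def using assms
    by (subst discounted_walk.simps) (simp add: pmf_bind[of "bernoulli_pmf \<alpha>"])
  then show ?thesis
    using assms by (simp add: pmf_bind_pmf_of_set ppr_def)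
qed

lemma ppr_nonneg: "ppr \<alpha> G u t \<ge> 0" and ppr_le_1: "ppr \<alpha> G u t \<le> 1"
  by (simp_all add: ppr_def pmf_le_1)

lemma ppr_self_ge:
  assumes "0 < \<alpha>" "\<alpha> < 1" "finite (out_nbrs G t)" "out_nbrs G t \<noteq> {}"
  shows "ppr \<alpha> G t t \<ge> \<alpha>"
  using assms by (simp add: ppr_unfold[of \<alpha> G t] ppr_nonneg sum_nonneg)

lemma ppr_ge_out_nbr:
  assumes "0 < \<alpha>" "\<alpha> < 1" "finite (out_nbrs G u)" "v \<in> out_nbrs G u"
  shows "ppr \<alpha> G u t \<ge> (1 - \<alpha>) / real (card (out_nbrs G u)) * ppr \<alpha> G v t"
proof -
  have "ppr \<alpha> G v t \<le> (\<Sum>w\<in>out_nbrs G u. ppr \<alpha> G w t)"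
    using assms by (intro member_le_sum) (auto simp: ppr_nonneg)
  then have "(1 - \<alpha>) * (ppr \<alpha> G v t / real (card (out_nbrs G u))) \<le>
      (1 - \<alpha>) * ((\<Sum>w\<in>out_nbrs G u. ppr \<alpha> G w t) / real (card (out_nbrs G u)))"
    using assms by (intro mult_left_mono divide_right_mono) auto
  also have "\<dots> \<le> ppr \<alpha> G u t"
    using assms by (subst ppr_unfold[of \<alpha> G u]) auto
  finally show ?thesis by simp
qed

text \<open>Inside \<open>R\<close> the recursion has no term for stopping at \<open>t\<close>, so
  each unfolding gains a factor \<open>1 - \<alpha>\<close>. Starting from the trivial bound 1, the
  value is at most \<open>(1 - \<alpha>) ^ k\<close> for every \<open>k\<close>.\<close>

lemma ppr_eq_0_if_closed:
  assumes "0 < \<alpha>" "\<alpha> < 1"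
    and closed: "\<And>u. u \<in> R \<Longrightarrow> finite (out_nbrs G u) \<and> out_nbrs G u \<noteq> {} \<and> out_nbrs G u \<subseteq> R"
    and "t \<notin> R" "u \<in> R"
  shows "ppr \<alpha> G u t = 0"
proof -
  have bound: "ppr \<alpha> G u t \<le> (1 - \<alpha>) ^ k" if "u \<in> R" for k u
    using that
  proof (induction k arbitrary: u)
    case 0
    then show ?case by (simp add: ppr_le_1)
  next
    case (Suc k)
    note u = closed[OF Suc.prems]
    then have "0 < card (out_nbrs G u)" by (simp add: card_gt_0_iff)
    have "(\<Sum>v\<in>out_nbrs G u. ppr \<alpha> G v t) \<le> (\<Sum>v\<in>out_nbrs G u. (1 - \<alpha>) ^ k)"
      using u by (intro sum_mono Suc.IH) auto
    then have "(\<Sum>v\<in>out_nbrs G u. ppr \<alpha> G v t) / real (card (out_nbrs G u)) \<le> (1 - \<alpha>) ^ k"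
      using \<open>0 < card _\<close> by (simp add: field_simps)
    then have "(1 - \<alpha>) * ((\<Sum>v\<in>out_nbrs G u. ppr \<alpha> G v t) / real (card (out_nbrs G u))) \<le>
        (1 - \<alpha>) * (1 - \<alpha>) ^ k"
      using assms by (intro mult_left_mono) auto
    moreover have "u \<noteq> t" using Suc.prems \<open>t \<notin> R\<close> by blast
    ultimately show ?case
      using u assms by (subst ppr_unfold) auto
  qed
  have "(\<lambda>k. (1 - \<alpha>) ^ k) \<longlonglongrightarrow> 0"
    using assms by (intro LIMSEQ_power_zero) auto
  then have "ppr \<alpha> G u t \<le> 0"
    by (rule LIMSEQ_le_const) (use bound[OF \<open>u \<in> R\<close>] in auto)
  then show ?thesis using ppr_nonneg[of \<alpha> G u t] by simp
qed

section \<open>Degrees, and exchanging the heads of two arcs\<close>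

lemma out_degree_eq_card: "out_degree (with_proj G) u = card (out_nbrs G u)"
proof -
  have "out_arcs (with_proj G) u = Pair u ` out_nbrs G u"
    by (auto simp: out_arcs_def out_nbrs_def)
  then show ?thesis by (simp add: out_degree_def card_image inj_on_def)
qed

lemma in_degree_eq_card: "in_degree (with_proj G) u = card (in_nbrs G u)"
proof -
  have "in_arcs (with_proj G) u = (\<lambda>v. (v, u)) ` in_nbrs G u"
    by (auto simp: in_arcs_def in_nbrs_def)
  then show ?thesis by (simp add: in_degree_def card_image inj_on_def)
qed

lemma pair_fin_digraph_iff:
  "pair_fin_digraph G \<longleftrightarrow> finite (pverts G) \<and> parcs G \<subseteq> pverts G \<times> pverts G"
proof
  assume "pair_fin_digraph G"
  then interpret pair_fin_digraph G .
  show "finite (pverts G) \<and> parcs G \<subseteq> pverts G \<times> pverts G"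
    using in_arcsD1 in_arcsD2 by auto
next
  assume *: "finite (pverts G) \<and> parcs G \<subseteq> pverts G \<times> pverts G"
  then have "finite (parcs G)" by (meson finite_SigmaI finite_subset)
  with * show "pair_fin_digraph G" by unfold_locales auto
qed

text \<open>Relabelling heads by a bijection makes the new out-neighborhoods images of the old ones,
  so out-degrees are preserved at once. Under the hypotheses of \<open>swappable\<close> this is
  exactly the replacement of \<open>(u, v)\<close>, \<open>(x, y)\<close> by \<open>(u, y)\<close>,
  \<open>(x, v)\<close>.\<close>

definition swap_arcs ::
    "'a \<Rightarrow> 'a \<Rightarrow> 'a \<Rightarrow> 'a \<Rightarrow> 'a pair_pre_digraph \<Rightarrow> 'a pair_pre_digraph" where
  "swap_arcs u v x y G = \<lparr>pverts = pverts G,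
     parcs = {(a, b). (a, if a \<in> {u, x} then Transposition.transpose v y b else b) \<in> parcs G}\<rparr>"

text \<open>Entries are renamed in place, so every list position that does not show a swapped arc
  keeps its content.\<close>

definition swap_lists :: "nat \<Rightarrow> nat \<Rightarrow> nat \<Rightarrow> nat \<Rightarrow> adj_lists \<Rightarrow> adj_lists" where
  "swap_lists u v x y L = \<lparr>
     out_list = (\<lambda>a. if a \<in> {u, x} then map (Transposition.transpose v y) (out_list L a) else out_list L a),
     in_list = (\<lambda>b. if b \<in> {v, y} then map (Transposition.transpose u x) (in_list L b) else in_list L b),
     in_sorted_list = (\<lambda>b. if b \<in> {v, y} then map (Transposition.transpose u x) (in_sorted_list L b)
        else in_sorted_list L b)\<rparr>"

text \<open>Equal out-degrees of \<open>u\<close> and \<open>x\<close> allow the two to trade places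
  in an \<open>in_sorted_list\<close> without disturbing its order.\<close>

locale swappable =
  fixes G :: "nat pair_pre_digraph" and u v x y :: nat
  assumes input_graph: "input_graph G"
    and arcs: "(u, v) \<in> parcs G" "(x, y) \<in> parcs G"
    and non_arcs: "(u, y) \<notin> parcs G" "(x, v) \<notin> parcs G"
    and same_degree: "card (out_nbrs G u) = card (out_nbrs G x)"
begin

abbreviation "G' \<equiv> swap_arcs u v x y G"

lemma pverts_swap [simp]: "pverts G' = pverts G"
  by (simp add: swap_arcs_def)

lemma endpoints: "u \<in> pverts G" "v \<in> pverts G" "x \<in> pverts G" "y \<in> pverts G"
  using input_graph arcs by (auto simp: input_graph_def pair_fin_digraph_iff)

lemma out_nbrs_swap:
  "out_nbrs G' a = (if a \<in> {u, x} then Transposition.transpose v y ` out_nbrs G a else out_nbrs G a)"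
  by (auto simp: out_nbrs_def swap_arcs_def in_transpose_image_iff)

text \<open>The swap is defined through tails. Seen from the heads it exchanges \<open>u\<close> and
  \<open>x\<close>, because \<open>v\<close> has the in-neighbor \<open>u\<close> but not
  \<open>x\<close>, and \<open>y\<close> has \<open>x\<close> but not \<open>u\<close>.\<close>

lemma in_nbrs_swap:
  "in_nbrs G' b = (if b \<in> {v, y} then Transposition.transpose u x ` in_nbrs G b else in_nbrs G b)"
  using arcs non_arcs
  by (auto simp: in_nbrs_def swap_arcs_def in_transpose_image_iff)
    (auto simp: Transposition.transpose_def split: if_splits)

lemma parcs_swap_iff:
  assumes "\<not> (a \<in> {u, x} \<and> b \<in> {v, y})"
  shows "(a, b) \<in> parcs G' \<longleftrightarrow> (a, b) \<in> parcs G"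
  using assms by (auto simp: swap_arcs_def)

lemma card_out_nbrs_swap: "card (out_nbrs G' a) = card (out_nbrs G a)"
  by (simp add: out_nbrs_swap card_image)

lemma card_in_nbrs_swap: "card (in_nbrs G' b) = card (in_nbrs G b)"
  by (simp add: in_nbrs_swap card_image)

lemma input_graph_swap: "input_graph G'"
proof -
  have "parcs G' \<subseteq> pverts G \<times> pverts G"
    using input_graph endpoints
    by (fastforce simp: input_graph_def pair_fin_digraph_iff swap_arcs_def
        Transposition.transpose_def split: if_splits)
  then show ?thesis
    using input_graph
    by (simp add: input_graph_def pair_fin_digraph_iff out_degree_eq_card card_out_nbrs_swap)
qed

lemma card_out_nbrs_transpose: "card (out_nbrs G (Transposition.transpose u x a)) = card (out_nbrs G a)"
  using same_degree by (auto simp: Transposition.transpose_def)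

text \<open>Transpositions are injective, which keeps lists distinct. Sortedness survives because
  the out-degree function is unchanged both by the swap and by composition with the transposition of
  \<open>u\<close> and \<open>x\<close>.\<close>

lemma represents_swap:
  assumes "represents L G"
  shows "represents (swap_lists u v x y L) G'"
  unfolding represents_def pverts_swap
proof
  fix a assume "a \<in> pverts G"
  have degree: "out_degree (with_proj G') = out_degree (with_proj G)"
    by (simp add: fun_eq_iff out_degree_eq_card card_out_nbrs_swap)
  have degree_transpose:
    "out_degree (with_proj G) \<circ> Transposition.transpose u x = out_degree (with_proj G)"
    by (simp add: fun_eq_iff out_degree_eq_card card_out_nbrs_transpose)
  have a: "distinct (out_list L a)" "set (out_list L a) = out_nbrs G a"
    "distinct (in_list L a)" "set (in_list L a) = in_nbrs G a"
    "distinct (in_sorted_list L a)" "set (in_sorted_list L a) = in_nbrs G a"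
    "sorted (map (out_degree (with_proj G)) (in_sorted_list L a))"
    using assms \<open>a \<in> pverts G\<close> unfolding represents_def by blast+
  let ?L' = "swap_lists u v x y L"
  have "distinct (out_list ?L' a)" "set (out_list ?L' a) = out_nbrs G' a"
    using a unfolding out_nbrs_swap by (simp_all add: swap_lists_def distinct_map)
  moreover have "distinct (in_list ?L' a)" "set (in_list ?L' a) = in_nbrs G' a"
    "distinct (in_sorted_list ?L' a)" "set (in_sorted_list ?L' a) = in_nbrs G' a"
    using a unfolding in_nbrs_swap by (simp_all add: swap_lists_def distinct_map)
  moreover have "sorted (map (out_degree (with_proj G')) (in_sorted_list ?L' a))"
    using a(7) unfolding degree by (simp add: swap_lists_def degree_transpose)
  ultimately show "distinct (out_list ?L' a) \<and> set (out_list ?L' a) = out_nbrs G' a \<and>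
      distinct (in_list ?L' a) \<and> set (in_list ?L' a) = in_nbrs G' a \<and>
      distinct (in_sorted_list ?L' a) \<and> set (in_sorted_list ?L' a) = in_nbrs G' a \<and>
      sorted (map (out_degree (with_proj G')) (in_sorted_list ?L' a))"
    by blast
qed

end

text \<open>Degree and jump queries concern no pair; their replies are invariant under every swap.\<close>

fun queried_pair :: "adj_lists \<Rightarrow> query \<Rightarrow> nat \<times> nat" where
  "queried_pair L (In b i) = (in_list L b ! i, b)"
| "queried_pair L (Out a i) = (a, out_list L a ! i)"
| "queried_pair L (In_Sorted b i) = (in_sorted_list L b ! i, b)"
| "queried_pair L (Adj a b) = (a, b)"
| "queried_pair L q = undefined"

text \<open>A renamed list can differ only at entries moved by the transposition, and then the
  queried pair lies in \<open>{u, x} \<times> {v, y}\<close>. A position out of range yields an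
  arbitrary pair, which is harmless: list lengths are kept and both replies are
  \<open>Invalid\<close>.\<close>

lemma (in swappable) reply_swap:
  assumes "queried_pair L q \<notin> {u, x} \<times> {v, y}"
  shows "reply G' (swap_lists u v x y L) q = reply G L q"
  using assms
  by (cases q)
    (auto simp: out_degree_eq_card in_degree_eq_card card_out_nbrs_swap card_in_nbrs_swap
      swap_lists_def list_answer_def parcs_swap_iff)

section \<open>From undetected swaps to a lower bound on the running time\<close>

text \<open>The pair must be one of \<open>(u, v)\<close>, \<open>(u, y)\<close>,
  \<open>(x, v)\<close>, \<open>(x, y)\<close>. Each case fixes two of the four coordinates and
  leaves at most \<open>r\<^sup>2\<close> choices for the others.\<close>

lemma card_swaps_hitting_le:
  fixes U V X Y :: "'a set"
  assumes "finite U" "finite V" "finite X" "finite Y"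
    and "card U = r" "card V = r" "card X = r" "card Y = r"
  shows "card {(u, v, x, y) \<in> U \<times> V \<times> X \<times> Y. (a, b) \<in> {u, x} \<times> {v, y}} \<le> 4 * r\<^sup>2"
proof -
  have "card {(u, v, x, y) \<in> U \<times> V \<times> X \<times> Y. (a, b) \<in> {u, x} \<times> {v, y}} \<le>
      card (({a} \<times> {b} \<times> X \<times> Y \<union> {a} \<times> V \<times> X \<times> {b}) \<union> (U \<times> {b} \<times> {a} \<times> Y \<union> U \<times> V \<times> {a} \<times> {b}))"
    using assms by (intro card_mono) auto
  also have "\<dots> \<le> (card ({a} \<times> {b} \<times> X \<times> Y) + card ({a} \<times> V \<times> X \<times> {b})) +
      (card (U \<times> {b} \<times> {a} \<times> Y) + card (U \<times> V \<times> {a} \<times> {b}))"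
    by (intro order_trans[OF card_Un_le] add_mono order_refl)
  also have "\<dots> = 4 * r\<^sup>2"
    using assms by (simp add: card_cartesian_product power2_eq_square)
  finally show ?thesis .
qed

text \<open>Outputs close to 0 have probability at least \<open>1 - p\<^sub>f\<close> on
  \<open>G\<close> and at most \<open>p\<^sub>f\<close> after each of the \<open>r ^ 4\<close>
  swaps, while the counting bound limits the total drop to \<open>4 * r\<^sup>2\<close> times the
  expected time.\<close>

lemma expected_time_ge_if_swaps_matter:
  fixes U V X Y :: "nat set"
  assumes "input_graph G" "represents L G" "s \<in> pverts G" "t \<in> pverts G"
    and param: "0 < \<epsilon>" "\<epsilon> < 1" "0 < p\<^sub>f" "p\<^sub>f < 1/2" "0 < \<delta>" "\<delta> \<le> 1"
    and fin: "finite U" "finite V" "finite X" "finite Y"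
    and card: "card U = r" "card V = r" "card X = r" "card Y = r" and "0 < r"
    and swappable: "\<And>u v x y. u \<in> U \<Longrightarrow> v \<in> V \<Longrightarrow> x \<in> X \<Longrightarrow> y \<in> Y \<Longrightarrow> swappable G u v x y"
    and zero: "ppr \<alpha> G s t = 0"
    and large: "\<And>u v x y. u \<in> U \<Longrightarrow> v \<in> V \<Longrightarrow> x \<in> X \<Longrightarrow> y \<in> Y \<Longrightarrow>
      ppr \<alpha> (swap_arcs u v x y G) s t \<ge> \<delta> / (1 - \<epsilon>)"
    and solves: "solves_single_pair \<alpha> \<epsilon> p\<^sub>f A"
  shows "expected_time A G L s t \<delta> \<ge> ennreal ((1 - 2 * p\<^sub>f) * real r ^ 2 / 4)"
proof (cases "expected_time A G L s t \<delta>")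
  case (real \<tau>)
  define I where "I = U \<times> V \<times> X \<times> Y"
  define G' where "G' = (\<lambda>(u, v, x, y). swap_arcs u v x y G)"
  define L' where "L' = (\<lambda>(u, v, x, y). swap_lists u v x y L)"
  \<comment> \<open>These are exactly the outcomes that are correct for the value 0.
    \<open>None\<close> is left out because non-termination counts as failure.\<close>
  define S :: "(real \<times> nat) option set"
    where "S = {r. case r of None \<Rightarrow> False | Some (z, k) \<Rightarrow> \<bar>z\<bar> < \<epsilon> * \<delta>}"
  have "finite I" "card I = r ^ 4"
    using fin card by (simp_all add: I_def card_cartesian_product power4_eq_xxxx)
  have hits: "card {i\<in>I. reply (G' i) (L' i) q \<noteq> reply G L q} \<le> 4 * r\<^sup>2" for q
  proof -
    obtain a b where ab: "queried_pair L q = (a, b)" by fastforce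
    have "card {i\<in>I. reply (G' i) (L' i) q \<noteq> reply G L q} \<le>
        card {(u, v, x, y) \<in> U \<times> V \<times> X \<times> Y. (a, b) \<in> {u, x} \<times> {v, y}}"
    proof (intro card_mono)
      show "finite {(u, v, x, y) \<in> U \<times> V \<times> X \<times> Y. (a, b) \<in> {u, x} \<times> {v, y}}"
        by (rule finite_subset[OF _ \<open>finite I\<close>]) (auto simp: I_def)
      show "{i\<in>I. reply (G' i) (L' i) q \<noteq> reply G L q} \<subseteq>
          {(u, v, x, y) \<in> U \<times> V \<times> X \<times> Y. (a, b) \<in> {u, x} \<times> {v, y}}"
      proof clarify
        fix u v x y
        assume "(u, v, x, y) \<in> I"
          and "reply (G' (u, v, x, y)) (L' (u, v, x, y)) q \<noteq> reply G L q"
        then show "(u, v, x, y) \<in> U \<times> V \<times> X \<times> Y \<and> (a, b) \<in> {u, x} \<times> {v, y}"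
          using swappable.reply_swap[OF swappable, of u v x y L q] ab
          by (auto simp: I_def G'_def L'_def)
      qed
    qed
    also have "\<dots> \<le> 4 * r\<^sup>2"
      by (rule card_swaps_hitting_le) (use fin card in auto)
    finally show ?thesis .
  qed
  have "measure_pmf.prob (run A G L s t \<delta>) (- S) \<le> p\<^sub>f"
  proof -
    have "- S = {r. failed \<epsilon> \<delta> 0 r}"
      using param by (auto simp: S_def failed_def not_less max_def split: option.splits)
    then show ?thesis
      using solves assms zero unfolding solves_single_pair_def by metis
  qed
  then have yes: "measure_pmf.prob (run A G L s t \<delta>) S \<ge> 1 - p\<^sub>f"
    using measure_pmf.prob_compl[of S "run A G L s t \<delta>"] by (simp add: Compl_eq_Diff_UNIV)
  have no: "measure_pmf.prob (run A (G' i) (L' i) s t \<delta>) S \<le> p\<^sub>f" if "i \<in> I" for i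
  proof -
    obtain u v x y where i: "i = (u, v, x, y)" by (cases i)
    with that have uvxy: "u \<in> U" "v \<in> V" "x \<in> X" "y \<in> Y" by (auto simp: I_def)
    interpret swappable G u v x y using uvxy by (rule swappable)
    define p where "p = ppr \<alpha> (swap_arcs u v x y G) s t"
    \<comment> \<open>An estimate with error below \<open>\<epsilon> * p\<close> exceeds
      \<open>(1 - \<epsilon>) * p\<close>, which is at least \<open>\<delta>\<close> and so at least
      \<open>\<epsilon> * \<delta>\<close>. Hence every outcome in \<open>S\<close> fails on the
      swapped graph.\<close>
    have "\<delta> / (1 - \<epsilon>) \<le> p" unfolding p_def by (rule large) (fact uvxy)+
    then have "\<delta> \<le> (1 - \<epsilon>) * p" using param by (simp add: field_simps)
    moreover have "\<epsilon> * \<delta> \<le> \<delta>" using param by simp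
    ultimately have "\<epsilon> * \<delta> \<le> p - \<epsilon> * p" by (simp add: algebra_simps)
    moreover have "\<delta> \<le> p"
    proof -
      have "0 \<le> p" unfolding p_def by (rule ppr_nonneg)
      then have "(1 - \<epsilon>) * p \<le> 1 * p" using param by (intro mult_right_mono) auto
      with \<open>\<delta> \<le> (1 - \<epsilon>) * p\<close> show ?thesis by simp
    qed
    ultimately have "S \<subseteq> {r. failed \<epsilon> \<delta> p r}"
      by (auto simp: S_def failed_def max_def split: option.splits)
    then have "measure_pmf.prob (run A (G' i) (L' i) s t \<delta>) S \<le>
        measure_pmf.prob (run A (G' i) (L' i) s t \<delta>) {r. failed \<epsilon> \<delta> p r}"
      by (intro measure_pmf.finite_measure_mono) auto
    also have "\<dots> \<le> p\<^sub>f"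
      using solves input_graph_swap represents_swap[OF \<open>represents L G\<close>] assms(3,4) param
      unfolding solves_single_pair_def p_def G'_def L'_def i by auto
    finally show ?thesis .
  qed
  have "ennreal (\<Sum>i\<in>I. measure_pmf.prob (run A G L s t \<delta>) S) =
      (\<Sum>i\<in>I. emeasure (run A G L s t \<delta>) S)"
    by (simp add: measure_pmf.emeasure_eq_measure sum_ennreal del: sum_constant)
  also have "\<dots> \<le> (\<Sum>i\<in>I. emeasure (run A (G' i) (L' i) s t \<delta>) S) +
      of_nat (4 * r\<^sup>2) * expected_time A G L s t \<delta>"
    unfolding S_def using \<open>finite I\<close> hits by (rule sum_emeasure_output_le)
  also have "\<dots> = ennreal (\<Sum>i\<in>I. measure_pmf.prob (run A (G' i) (L' i) s t \<delta>) S) +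
      ennreal (real (4 * r\<^sup>2)) * ennreal \<tau>"
    by (simp add: measure_pmf.emeasure_eq_measure real ennreal_of_nat_eq_real_of_nat
        del: of_nat_mult of_nat_power)
  also have "\<dots> = ennreal ((\<Sum>i\<in>I. measure_pmf.prob (run A (G' i) (L' i) s t \<delta>) S) +
      real (4 * r\<^sup>2) * \<tau>)"
    using real by (simp add: ennreal_mult ennreal_plus sum_nonneg del: of_nat_mult of_nat_power)
  finally have "(\<Sum>i\<in>I. measure_pmf.prob (run A G L s t \<delta>) S) \<le>
      (\<Sum>i\<in>I. measure_pmf.prob (run A (G' i) (L' i) s t \<delta>) S) + real (4 * r\<^sup>2) * \<tau>"
    using real by (subst (asm) ennreal_le_iff) (auto intro!: add_nonneg_nonneg sum_nonneg)
  moreover have "(\<Sum>i\<in>I. 1 - p\<^sub>f) \<le> (\<Sum>i\<in>I. measure_pmf.prob (run A G L s t \<delta>) S)"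
    using yes by (intro sum_mono)
  moreover have "(\<Sum>i\<in>I. measure_pmf.prob (run A (G' i) (L' i) s t \<delta>) S) \<le> (\<Sum>i\<in>I. p\<^sub>f)"
    using no by (intro sum_mono)
  ultimately have "real r ^ 4 * (1 - p\<^sub>f) \<le> real r ^ 4 * p\<^sub>f + 4 * real r ^ 2 * \<tau>"
    using \<open>card I = r ^ 4\<close> by simp
  then have "real r ^ 2 * (real r ^ 2 * (1 - 2 * p\<^sub>f)) \<le> real r ^ 2 * (4 * \<tau>)"
    by (simp add: algebra_simps power4_eq_xxxx power2_eq_square)
  then have "(1 - 2 * p\<^sub>f) * real r ^ 2 / 4 \<le> \<tau>"
    using \<open>0 < r\<close> by (subst (asm) mult_le_cancel_left_pos) (simp_all add: mult.commute)
  then show ?thesis using real by (simp add: ennreal_leI)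
next
  case top
  then show ?thesis by simp
qed

section \<open>The hard graph\<close>

text \<open>Node 0 is the source and 1 the target. Four blocks of \<open>r\<close> nodes follow,
  then \<open>n\<close> padding nodes carrying the arcs \<open>F\<close>, which set the size of the
  graph without touching the rest. The loops in \<open>F\<close> give each padding node an
  out-neighbor.\<close>

locale two_bicliques =
  fixes r n :: nat and F :: "(nat \<times> nat) set"
  assumes r_pos: "0 < r"
    and F: "Id_on {2 + 4 * r..<2 + 4 * r + n} \<subseteq> F"
      "F \<subseteq> {2 + 4 * r..<2 + 4 * r + n} \<times> {2 + 4 * r..<2 + 4 * r + n}"
begin

definition "U = {2..<2 + r}"
definition "V = {2 + r..<2 + 2 * r}"
definition "X = {2 + 2 * r..<2 + 3 * r}"
definition "Y = {2 + 3 * r..<2 + 4 * r}"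
definition "W = {2 + 4 * r..<2 + 4 * r + n}"
text \<open>The loops on \<open>V\<close> trap the walk from the source away from the target;
  together with the loop at 1 they also ensure that no node lacks an out-neighbor.\<close>

definition "G = \<lparr>pverts = {..<2 + 4 * r + n},
  parcs = {0} \<times> U \<union> U \<times> V \<union> Id_on V \<union> X \<times> Y \<union> Y \<times> {1} \<union> {(1, 1)} \<union> F\<rparr>"

lemmas blocks_def = U_def V_def X_def Y_def W_def

lemma F_W: "Id_on W \<subseteq> F" "F \<subseteq> W \<times> W"
  using F by (simp_all add: W_def)

lemma card_blocks [simp]: "card U = r" "card V = r" "card X = r" "card Y = r" "card W = n"
  by (simp_all add: blocks_def)

lemma finite_blocks [simp]: "finite U" "finite V" "finite X" "finite Y" "finite W"
  by (simp_all add: blocks_def)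

lemma parcs_G: "parcs G =
    {0} \<times> U \<union> U \<times> V \<union> Id_on V \<union> X \<times> Y \<union> Y \<times> {1} \<union> {(1, 1)} \<union> F"
  by (simp add: G_def)

lemma pverts_G: "pverts G = {0, 1} \<union> U \<union> V \<union> X \<union> Y \<union> W"
  by (auto simp: G_def blocks_def)

lemma blocks_disjoint:
  "U \<inter> V = {}" "U \<inter> X = {}" "U \<inter> Y = {}" "U \<inter> W = {}" "V \<inter> X = {}"
  "V \<inter> Y = {}" "V \<inter> W = {}" "X \<inter> Y = {}" "X \<inter> W = {}" "Y \<inter> W = {}"
  "0 \<notin> U" "0 \<notin> V" "0 \<notin> X" "0 \<notin> Y" "0 \<notin> W"
  "1 \<notin> U" "1 \<notin> V" "1 \<notin> X" "1 \<notin> Y" "1 \<notin> W"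
  by (auto simp: blocks_def)

lemma blocks_nonempty: "U \<noteq> {}" "V \<noteq> {}" "X \<noteq> {}" "Y \<noteq> {}"
  using r_pos by (simp_all add: blocks_def)

lemma not_in_F: "a \<notin> W \<Longrightarrow> (a, b) \<notin> F"
  using F_W by blast

lemma out_nbrs_G:
  "out_nbrs G 0 = U" "out_nbrs G 1 = {1}"
  "u \<in> U \<Longrightarrow> out_nbrs G u = V" "v \<in> V \<Longrightarrow> out_nbrs G v = {v}"
  "x \<in> X \<Longrightarrow> out_nbrs G x = Y" "y \<in> Y \<Longrightarrow> out_nbrs G y = {1}"
  "w \<in> W \<Longrightarrow> w \<in> out_nbrs G w"
  using F_W not_in_F unfolding out_nbrs_def parcs_G by (auto simp: blocks_def Id_on_iff)

lemma finite_out_nbrs_G: "finite (out_nbrs G a)"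
proof (rule finite_subset)
  show "out_nbrs G a \<subseteq> U \<union> V \<union> Y \<union> W \<union> {1}"
    unfolding out_nbrs_def parcs_G using F_W by blast
qed simp

lemma parcs_G_subset: "parcs G \<subseteq> pverts G \<times> pverts G"
  unfolding parcs_G pverts_G using F_W by blast

lemma input_graph_G: "input_graph G"
proof -
  note parcs_G_subset
  moreover have "out_nbrs G a \<noteq> {}" if "a \<in> pverts G" for a
    using that blocks_nonempty out_nbrs_G(7)[of a] unfolding pverts_G
    by (auto simp: out_nbrs_G(1-6) simp del: One_nat_def)
  moreover have "pverts G = {..<2 + 4 * r + n}" by (simp add: G_def)
  ultimately show ?thesis
    by (auto simp: input_graph_def pair_fin_digraph_iff out_degree_eq_card card_gt_0_iff
        finite_out_nbrs_G)
qed

lemma card_pverts_G: "card (pverts G) = 2 + 4 * r + n"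
  by (simp add: G_def)

lemma card_parcs_G_ge: "card F \<le> card (parcs G)"
proof (rule card_mono)
  show "finite (parcs G)"
    by (rule finite_subset[OF parcs_G_subset]) (simp add: G_def)
qed (auto simp: parcs_G)

lemma card_parcs_G_le: "card (parcs G) \<le> 3 * r + 2 * r\<^sup>2 + 1 + card F"
proof -
  have "card (parcs G) \<le> card ({0::nat} \<times> U) + card (U \<times> V) + card (Id_on V) + card (X \<times> Y) +
      card (Y \<times> {1::nat}) + card {(1::nat, 1::nat)} + card F"
    unfolding parcs_G by (intro order_trans[OF card_Un_le] add_right_mono order_refl)
  also have "card (Id_on V) = r"
    by (simp add: Id_on_def UNION_singleton_eq_range card_image inj_on_def)
  finally show ?thesis
    by (simp add: card_cartesian_product power2_eq_square)
qed

lemma swappable_G: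
  assumes "u \<in> U" "v \<in> V" "x \<in> X" "y \<in> Y"
  shows "swappable G u v x y"
proof
  show "(u, y) \<notin> parcs G" "(x, v) \<notin> parcs G"
    using assms out_nbrs_G(3)[of u] out_nbrs_G(5)[of x] blocks_disjoint
    by (auto simp: out_nbrs_def)
qed (use assms in \<open>auto simp: input_graph_G out_nbrs_G parcs_G\<close>)

lemma ppr_G_eq_0:
  assumes "0 < \<alpha>" "\<alpha> < 1"
  shows "ppr \<alpha> G 0 1 = 0"
proof (rule ppr_eq_0_if_closed[where R = "{0} \<union> U \<union> V"])
  fix a assume "a \<in> {0} \<union> U \<union> V"
  then show "finite (out_nbrs G a) \<and> out_nbrs G a \<noteq> {} \<and> out_nbrs G a \<subseteq> {0} \<union> U \<union> V"
    using blocks_nonempty by (auto simp: out_nbrs_G)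
qed (use assms blocks_disjoint in auto)

text \<open>Only the path from 0 through \<open>u\<close> and \<open>y\<close> to 1 is counted. Its
  three steps leave nodes of out-degree \<open>r\<close>, \<open>r\<close> and 1, and stopping at
  the target contributes \<open>\<alpha>\<close>.\<close>

lemma ppr_swap_ge:
  assumes "0 < \<alpha>" "\<alpha> < 1" and uvxy: "u \<in> U" "v \<in> V" "x \<in> X" "y \<in> Y"
  shows "ppr \<alpha> (swap_arcs u v x y G) 0 1 \<ge> \<alpha> * (1 - \<alpha>) ^ 3 / real r ^ 2"
proof -
  interpret swappable G u v x y using uvxy by (rule swappable_G)
  have y: "out_nbrs G' y = {1}" and one: "out_nbrs G' 1 = {1}" and zero: "out_nbrs G' 0 = U"
    using uvxy blocks_disjoint by (auto simp: out_nbrs_swap out_nbrs_G simp del: One_nat_def)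
  have u: "y \<in> out_nbrs G' u" "finite (out_nbrs G' u)" "card (out_nbrs G' u) = r"
    using uvxy by (simp_all add: out_nbrs_swap out_nbrs_G in_transpose_image_iff card_image)
  have "\<alpha> \<le> ppr \<alpha> G' 1 1"
    using assms by (intro ppr_self_ge) (auto simp: one simp del: One_nat_def)
  then have "(1 - \<alpha>) * \<alpha> \<le> (1 - \<alpha>) * ppr \<alpha> G' 1 1"
    using assms by (intro mult_left_mono) auto
  also have "\<dots> \<le> ppr \<alpha> G' y 1"
    using ppr_ge_out_nbr[of \<alpha> G' y 1 1] assms y by simp
  finally have "(1 - \<alpha>) / r * ((1 - \<alpha>) * \<alpha>) \<le> (1 - \<alpha>) / r * ppr \<alpha> G' y 1"
    using assms by (intro mult_left_mono) auto
  also have "\<dots> \<le> ppr \<alpha> G' u 1"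
    using ppr_ge_out_nbr[of \<alpha> G' u y 1] assms u by simp
  finally have "(1 - \<alpha>) / r * ((1 - \<alpha>) / r * ((1 - \<alpha>) * \<alpha>)) \<le> (1 - \<alpha>) / r * ppr \<alpha> G' u 1"
    using assms by (intro mult_left_mono) auto
  also have "\<dots> \<le> ppr \<alpha> G' 0 1"
    using ppr_ge_out_nbr[of \<alpha> G' 0 u 1] assms zero by simp
  finally show ?thesis
    by (simp add: power2_eq_square power3_eq_cube mult_ac)
qed

text \<open>The bound on \<open>r\<close> says precisely that the probability
  \<open>\<alpha> * (1 - \<alpha>) ^ 3 / real r ^ 2\<close> gained by a swap reaches the detection
  threshold \<open>\<delta> / (1 - \<epsilon>)\<close>.\<close>

lemma expected_time_G_ge:
  assumes "0 < \<alpha>" "\<alpha> < 1" "0 < \<epsilon>" "\<epsilon> < 1" "0 < p\<^sub>f" "p\<^sub>f < 1/2" "0 < \<delta>" "\<delta> \<le> 1"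
    and r: "real r ^ 2 \<le> \<alpha> * (1 - \<alpha>) ^ 3 * (1 - \<epsilon>) / \<delta>"
    and "represents L G" "solves_single_pair \<alpha> \<epsilon> p\<^sub>f A"
  shows "expected_time A G L 0 1 \<delta> \<ge> ennreal ((1 - 2 * p\<^sub>f) * real r ^ 2 / 4)"
proof (rule expected_time_ge_if_swaps_matter[of G L 0 1 \<epsilon> p\<^sub>f \<delta> U V X Y r \<alpha>])
  fix u v x y assume uvxy: "u \<in> U" "v \<in> V" "x \<in> X" "y \<in> Y"
  have "\<delta> / (1 - \<epsilon>) \<le> \<alpha> * (1 - \<alpha>) ^ 3 / real r ^ 2"
    using r r_pos assms(3,4,7) by (simp add: field_simps)
  also have "\<dots> \<le> ppr \<alpha> (swap_arcs u v x y G) 0 1"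
    by (rule ppr_swap_ge) (use assms uvxy in auto)
  finally show "\<delta> / (1 - \<epsilon>) \<le> ppr \<alpha> (swap_arcs u v x y G) 0 1" .
qed (use assms in \<open>auto simp: input_graph_G pverts_G r_pos swappable_G ppr_G_eq_0
      simp del: One_nat_def\<close>)

end

section \<open>Choice of the parameters\<close>

lemma exists_padding_arcs:
  fixes W :: "'a set"
  assumes "finite W" "card W \<le> m" "m \<le> (card W)\<^sup>2"
  obtains F where "Id_on W \<subseteq> F" "F \<subseteq> W \<times> W" "card F = m"
proof -
  have "card (Id_on W) = card W"
    by (simp add: Id_on_def UNION_singleton_eq_range card_image inj_on_def)
  then obtain F where "Id_on W \<subseteq> F" "F \<subseteq> W \<times> W" "card F = m"
    using exists_subset_between[of "Id_on W" m "W \<times> W"] assms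
    by (auto simp: card_cartesian_product power2_eq_square)
  then show thesis by (rule that)
qed

text \<open>Take the floor of the square root. As it is at least 1, adding 1 at most doubles it,
  whence the factor 4.\<close>

lemma exists_nat_square_between:
  fixes z :: real
  assumes "1 \<le> z"
  obtains r :: nat where "0 < r" "real r ^ 2 \<le> z" "z \<le> 4 * real r ^ 2"
proof
  define r where "r = nat \<lfloor>sqrt z\<rfloor>"
  have "1 \<le> sqrt z" using assms by simp
  then have r: "real r \<le> sqrt z" "sqrt z < real r + 1" "1 \<le> r"
    unfolding r_def by linarith+
  then show "0 < r" by simp
  have "real r ^ 2 \<le> sqrt z ^ 2" using r by (intro power_mono) auto
  then show "real r ^ 2 \<le> z" using assms by simp
  have "sqrt z ^ 2 \<le> (2 * real r) ^ 2" using r assms by (intro power_mono) auto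
  then show "z \<le> 4 * real r ^ 2" using assms by simp
qed

theorem theorem3p1:
  fixes \<alpha> \<epsilon> p\<^sub>f :: real
  assumes "0 < \<alpha>" "\<alpha> < 1"
    and "0 < \<epsilon>" "\<epsilon> < 1"
    and "0 < p\<^sub>f" "p\<^sub>f < 1/2"
  shows "\<exists>c\<^sub>1>0. \<exists>c\<^sub>2>0. \<exists>c>0. \<forall>(n::nat) (m::nat) (\<delta>::real).
    1 \<le> n \<and> n \<le> m \<and> m \<le> n\<^sup>2 \<and> 0 < \<delta> \<and> \<delta> \<le> 1 \<longrightarrow>
    (\<exists>G s t. input_graph G \<and> s \<in> pverts G \<and> t \<in> pverts G \<and>
       c\<^sub>1 * real n \<le> real (card (pverts G)) \<and> real (card (pverts G)) \<le> c\<^sub>2 * real n \<and>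
       c\<^sub>1 * real m \<le> real (card (parcs G)) \<and> real (card (parcs G)) \<le> c\<^sub>2 * real m \<and>
       (\<forall>L A. represents L G \<and> solves_single_pair \<alpha> \<epsilon> p\<^sub>f A \<longrightarrow>
          expected_time A G L s t \<delta> \<ge> ennreal (c * min (real m) (1 / \<delta>))))"
proof -
  \<comment> \<open>\<open>\<kappa> / \<delta>\<close> is the largest \<open>r\<^sup>2\<close> for
    which swaps must be detected. The 16 in \<open>c\<close> combines the 4 of the time bound with
    the 4 lost in rounding to a square.\<close>
  define \<kappa> where "\<kappa> = \<alpha> * (1 - \<alpha>) ^ 3 * (1 - \<epsilon>)"
  define c where "c = (1 - 2 * p\<^sub>f) * \<kappa> / 16"
  have "0 < \<kappa>" using assms by (simp add: \<kappa>_def)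
  have "\<kappa> \<le> 1"
    using assms unfolding \<kappa>_def by (intro mult_le_one power_le_one zero_le_power) auto
  have "0 < c" using \<open>0 < \<kappa>\<close> assms by (simp add: c_def)
  have "c \<le> \<kappa>"
  proof -
    have "(1 - 2 * p\<^sub>f) * \<kappa> \<le> 1 * \<kappa>" using \<open>0 < \<kappa>\<close> assms by (intro mult_right_mono) auto
    then show ?thesis using \<open>0 < \<kappa>\<close> by (simp add: c_def)
  qed
  \<comment> \<open>The 7 comes from \<open>2 + 4 * r + n\<close> nodes with
    \<open>r \<le> n\<close> and \<open>1 \<le> n\<close>, and from at most
    \<open>3 * r + 2 * r\<^sup>2 + 1 + m\<close> arcs with \<open>r\<close>, \<open>1\<close> and
    \<open>r\<^sup>2\<close> all at most \<open>m\<close>.\<close>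
  have main: "\<exists>G s t. input_graph G \<and> s \<in> pverts G \<and> t \<in> pverts G \<and>
       1 * real n \<le> real (card (pverts G)) \<and> real (card (pverts G)) \<le> 7 * real n \<and>
       1 * real m \<le> real (card (parcs G)) \<and> real (card (parcs G)) \<le> 7 * real m \<and>
       (\<forall>L A. represents L G \<and> solves_single_pair \<alpha> \<epsilon> p\<^sub>f A \<longrightarrow>
          expected_time A G L s t \<delta> \<ge> ennreal (c * min (real m) (1 / \<delta>)))"
    if "1 \<le> n" "n \<le> m" "m \<le> n\<^sup>2" "0 < \<delta>" "\<delta> \<le> 1" for n m :: nat and \<delta> :: real
  proof -
    define k where "k = min (real m) (1 / \<delta>)"
    have "1 \<le> k" using that by (simp add: k_def)
    \<comment> \<open>If \<open>\<kappa> * k < 1\<close>, no positive \<open>r\<close> meets the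
      threshold through \<open>\<kappa> * k\<close>; then \<open>r = 1\<close> merely builds some
      graph of the right size, and the time bound follows since every run costs at least one
      unit.\<close>
    obtain r :: nat where r: "0 < r" "r\<^sup>2 \<le> m"
      "\<kappa> * k < 1 \<or> real r ^ 2 \<le> \<kappa> * k \<and> \<kappa> * k \<le> 4 * real r ^ 2"
    proof (cases "1 \<le> \<kappa> * k")
      case True
      then obtain r :: nat where r: "0 < r" "real r ^ 2 \<le> \<kappa> * k" "\<kappa> * k \<le> 4 * real r ^ 2"
        by (rule exists_nat_square_between)
      have "\<kappa> * k \<le> 1 * k" using \<open>\<kappa> \<le> 1\<close> \<open>1 \<le> k\<close> by (intro mult_right_mono) auto
      also have "\<dots> \<le> real m" by (simp add: k_def)
      finally have "real r ^ 2 \<le> real m" using r by linarith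
      then have "r\<^sup>2 \<le> m" by (simp only: of_nat_power[symmetric] of_nat_le_iff)
      with r show ?thesis by (intro that[of r]) auto
    next
      case False
      with \<open>1 \<le> n\<close> \<open>n \<le> m\<close> show ?thesis by (intro that[of 1]) auto
    qed
    have "r \<le> n"
      using r(2) \<open>m \<le> n\<^sup>2\<close> by (meson le_trans power2_nat_le_eq_le)
    have "r \<le> r\<^sup>2" "1 \<le> r\<^sup>2" using \<open>0 < r\<close> by (simp_all add: power2_eq_square)
    let ?W = "{2 + 4 * r..<2 + 4 * r + n}"
    obtain F where F: "Id_on ?W \<subseteq> F" "F \<subseteq> ?W \<times> ?W" "card F = m"
      by (rule exists_padding_arcs[of ?W m]) (use \<open>n \<le> m\<close> \<open>m \<le> n\<^sup>2\<close> in auto)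
    interpret two_bicliques r n F using r F by unfold_locales auto
    have "ennreal (c * k) \<le> expected_time A G L 0 1 \<delta>"
      if L: "represents L G" and A: "solves_single_pair \<alpha> \<epsilon> p\<^sub>f A" for L A
      using r(3)
    proof
      assume "\<kappa> * k < 1"
      moreover have "c * k \<le> \<kappa> * k" using \<open>c \<le> \<kappa>\<close> \<open>1 \<le> k\<close> by (intro mult_right_mono) auto
      ultimately have "ennreal (c * k) \<le> ennreal 1" by (intro ennreal_leI) linarith
      also have "\<dots> \<le> expected_time A G L 0 1 \<delta>" by (simp add: expected_time_ge_1)
      finally show ?thesis .
    next
      assume *: "real r ^ 2 \<le> \<kappa> * k \<and> \<kappa> * k \<le> 4 * real r ^ 2"
      have "\<kappa> * k \<le> \<kappa> * (1 / \<delta>)" using \<open>0 < \<kappa>\<close> by (intro mult_left_mono) (auto simp: k_def)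
      with * have "real r ^ 2 \<le> \<alpha> * (1 - \<alpha>) ^ 3 * (1 - \<epsilon>) / \<delta>" by (simp add: \<kappa>_def)
      then have "ennreal ((1 - 2 * p\<^sub>f) * real r ^ 2 / 4) \<le> expected_time A G L 0 1 \<delta>"
        using assms \<open>0 < \<delta>\<close> \<open>\<delta> \<le> 1\<close> L A by (intro expected_time_G_ge) auto
      moreover have "c * k \<le> (1 - 2 * p\<^sub>f) * real r ^ 2 / 4"
      proof -
        have "c * k = (1 - 2 * p\<^sub>f) * (\<kappa> * k) / 16" by (simp add: c_def)
        also have "\<dots> \<le> (1 - 2 * p\<^sub>f) * (4 * real r ^ 2) / 16"
          using * assms by (intro divide_right_mono mult_left_mono) auto
        finally show ?thesis by (simp add: mult.commute)
      qed
      then have "ennreal (c * k) \<le> ennreal ((1 - 2 * p\<^sub>f) * real r ^ 2 / 4)"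
        by (rule ennreal_leI)
      ultimately show ?thesis by (rule order_trans[rotated])
    qed
    moreover have "card (pverts G) \<le> 7 * n" "n \<le> card (pverts G)"
      using \<open>r \<le> n\<close> \<open>1 \<le> n\<close> by (simp_all add: card_pverts_G)
    moreover have "card (parcs G) \<le> 7 * m" "m \<le> card (parcs G)"
      using card_parcs_G_le card_parcs_G_ge \<open>card F = m\<close> r(2) \<open>r \<le> r\<^sup>2\<close> \<open>1 \<le> r\<^sup>2\<close> by linarith+
    ultimately show ?thesis
      using input_graph_G unfolding k_def
      by (intro exI[of _ G] exI[of _ "0::nat"] exI[of _ "1::nat"] conjI allI impI)
        (simp_all add: pverts_G)
  qed
  show ?thesis
  proof (rule exI[of _ "1::real"], intro conjI, simp, rule exI[of _ "7::real"], intro conjI, simp,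
      rule exI[of _ c], intro conjI allI impI)
    show "0 < c" by fact
  qed (elim conjE, rule main)
qed

end
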